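(* Let $k\ge1$ and $1\le r\le(2k+1)^2$. Let $\overline{\mathcal{B}}(2k+1,2k+1;r)$ be the subset of $\mathcal{B}(2k+1,2k+1;r)$ consisting of all boards whose board partition $\begin{pmatrix}\lambda_1&\lambda_2&\lambda_3&\lambda_4\\ \delta_1&\delta_2&\delta_3&\delta_4\end{pmatrix}_c$ satisfies: (i) $\lambda_1\ge\lambda_i$ for all $i>1$; (ii) $\lambda_2\ge\lambda_4$; (iii) if $\lambda_1=\lambda_2$ then $\lambda_3\ge\lambda_4$; (iv) if $\lambda_1=\lambda_3$ and $\lambda_2\ne\lambda_4$, then $\delta_1\ge\delta_2$, and if moreover $\delta_1=\delta_2$ then $\delta_3\ge\delta_4$; (v) if $\lambda_2=\lambda_4$ and $\lambda_1\ne\lambda_3$, then $\delta_1\ge\delta_4$, and if moreover $\delta_1=\delta_4$ then $\delta_2\ge\delta_3$; (vi) if $\lambda_1=\lambda_2>\lambda_3=\lambda_4$ then $\delta_2\ge\delta_4$; (vii) if $\lambda_1=\lambda_3>\lambda_2=\lambda_4$ then $\delta_1\ge\delta_i$ for all $i$, and: if $\delta_1=\delta_2$ then $\delta_3\ge\delta_4$; if $\delta_1=\delta_3$ then $\delta_2\ge\delta_4$; if $\delta_1=\delta_4$ then $\delta_2\ge\delta_3$; (viii) if $\lambda_1=\lambda_2=\lambda_3=\lambda_4$ then $\delta_1\ge\delta_i$ for all $i$, $\delta_2\ge\delta_4$, and if $\delta_1=\delta_2$ then $\delta_3\ge\delta_4$. Then: (1) $\overline{\mathcal{B}}(2k+1,2k+1;r)$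 is a disjoint union of sets each consisting of all boards in $\mathcal{B}(2k+1,2k+1;r)$ with some fixed board partition; (2) every board of $\mathcal{B}(2k+1,2k+1;r)$ is equivalent under $D_4$ to some board of $\overline{\mathcal{B}}(2k+1,2k+1;r)$; (3) if two boards of $\overline{\mathcal{B}}(2k+1,2k+1;r)$ are equivalent under $D_4$, they have the same board partition.
   Context: A $(2k+1)\times(2k+1)$ grid has cells $(i,j)$ with rows numbered top to bottom and columns left to right. $\mathcal{B}(2k+1,2k+1;r)$ is the set of boards, i.e. subsets of exactly $r$ blocked cells; the dihedral group $D_4$ of the 8 symmetries of the square (four rotations about the center, reflections across the horizontal midline, vertical midline, and the two diagonals) acts on boards, and two boards are equivalent if some element maps one to the other. The grid is divided into nine regions: $\Lambda_1$ = rows $1..k$, cols $1..k$; $\Lambda_2$ = rows $1..k$, cols $k+2..2k+1$; $\Lambda_3$ = rows $k+2..2k+1$, cols $k+2..2k+1$; $\Lambda_4$ = rows $k+2..2k+1$, cols $1..k$; $\Delta_1$ = rows $1..k$, col $k+1$ (top strip); $\Delta_2$ = row $k+1$, cols $k+2..2k+1$ (right strip); $\Delta_3$ = rows $k+2..2k+1$, col $k+1$ (bottom strip); $\Delta_4$ = row $k+1$, cols $1..k$ (left strip); and the center cell $(k+1,k+1)$. The board partition $\begin{pmatrix}\lambda_1&\lambda_2&\lambda_3&\lambda_4\\ \delta_1&\delta_2&\delta_3&\delta_4\end{pmatrix}_c$ records the numbers $\lambda_i$, $\delta_i$ of blocked cells in $\Lambda_i$, $\Delta_i$, and $c\in\{0,1\}$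 the number of blocked cells at the center. *)

theory Defs
  imports Main "HOL-Library.Disjoint_Sets"
begin

text \<open>Cells of the (2k+1) x (2k+1) grid: pairs (row, column), both in 1..2k+1.\<close>

definition grid :: "nat \<Rightarrow> (nat \<times> nat) set" where
  "grid k = {1..2*k+1} \<times> {1..2*k+1}"

text \<open>Boards with exactly r blocked cells.\<close>

definition boards :: "nat \<Rightarrow> nat \<Rightarrow> (nat \<times> nat) set set" where
  "boards k r = {B. B \<subseteq> grid k \<and> card B = r}"

definition D4 :: "nat \<Rightarrow> ((nat \<times> nat) \<Rightarrow> (nat \<times> nat)) set" where
  "D4 k = (let m = 2*k+2 in
     {(\<lambda>(i,j). (i, j)),
      (\<lambda>(i,j). (j, m - i)),
      (\<lambda>(i,j). (m - i, m - j)),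
      (\<lambda>(i,j). (m - j, i)),
      (\<lambda>(i,j). (m - i, j)),
      (\<lambda>(i,j). (i, m - j)),
      (\<lambda>(i,j). (j, i)),
      (\<lambda>(i,j). (m - j, m - i))})"

definition board_equiv :: "nat \<Rightarrow> (nat \<times> nat) set \<Rightarrow> (nat \<times> nat) set \<Rightarrow> bool" where
  "board_equiv k B B' \<longleftrightarrow> (\<exists>g \<in> D4 k. g ` B = B')"

definition Lambda :: "nat \<Rightarrow> nat \<Rightarrow> (nat \<times> nat) set" where
  "Lambda k t = (if t = 1 then {1..k} \<times> {1..k}
     else if t = 2 then {1..k} \<times> {k+2..2*k+1}
     else if t = 3 then {k+2..2*k+1} \<times> {k+2..2*k+1}
     else if t = 4 then {k+2..2*k+1} \<times> {1..k}
     else {})"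

definition Delta :: "nat \<Rightarrow> nat \<Rightarrow> (nat \<times> nat) set" where
  "Delta k t = (if t = 1 then {1..k} \<times> {k+1}
     else if t = 2 then {k+1} \<times> {k+2..2*k+1}
     else if t = 3 then {k+2..2*k+1} \<times> {k+1}
     else if t = 4 then {k+1} \<times> {1..k}
     else {})"

definition center :: "nat \<Rightarrow> (nat \<times> nat) set" where
  "center k = {(k+1, k+1)}"

definition lam :: "nat \<Rightarrow> (nat \<times> nat) set \<Rightarrow> nat \<Rightarrow> nat" where
  "lam k B t = card (B \<inter> Lambda k t)"

definition del :: "nat \<Rightarrow> (nat \<times> nat) set \<Rightarrow> nat \<Rightarrow> nat" where
  "del k B t = card (B \<inter> Delta k t)"

definition cen :: "nat \<Rightarrow> (nat \<times> nat) set \<Rightarrow> nat" where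
  "cen k B = card (B \<inter> center k)"

definition board_partition ::
  "nat \<Rightarrow> (nat \<times> nat) set \<Rightarrow> (nat \<times> nat \<times> nat \<times> nat) \<times> (nat \<times> nat \<times> nat \<times> nat) \<times> nat" where
  "board_partition k B =
     ((lam k B 1, lam k B 2, lam k B 3, lam k B 4),
      (del k B 1, del k B 2, del k B 3, del k B 4), cen k B)"

definition good_partition :: "nat \<Rightarrow> nat \<Rightarrow> nat \<Rightarrow> nat \<Rightarrow> nat \<Rightarrow> nat \<Rightarrow> nat \<Rightarrow> nat \<Rightarrow> bool" where
  "good_partition l1 l2 l3 l4 d1 d2 d3 d4 \<longleftrightarrow>
     (l1 \<ge> l2 \<and> l1 \<ge> l3 \<and> l1 \<ge> l4) \<and>
     l2 \<ge> l4 \<and>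
     (l1 = l2 \<longrightarrow> l3 \<ge> l4) \<and>
     (l1 = l3 \<and> l2 \<noteq> l4 \<longrightarrow> d1 \<ge> d2 \<and> (d1 = d2 \<longrightarrow> d3 \<ge> d4)) \<and>
     (l2 = l4 \<and> l1 \<noteq> l3 \<longrightarrow> d1 \<ge> d4 \<and> (d1 = d4 \<longrightarrow> d2 \<ge> d3)) \<and>
     (l1 = l2 \<and> l2 > l3 \<and> l3 = l4 \<longrightarrow> d2 \<ge> d4) \<and>
     (l1 = l3 \<and> l3 > l2 \<and> l2 = l4 \<longrightarrow>
        d1 \<ge> d2 \<and> d1 \<ge> d3 \<and> d1 \<ge> d4 \<and>
        (d1 = d2 \<longrightarrow> d3 \<ge> d4) \<and> (d1 = d3 \<longrightarrow> d2 \<ge> d4) \<and> (d1 = d4 \<longrightarrow> d2 \<ge> d3)) \<and>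
     (l1 = l2 \<and> l2 = l3 \<and> l3 = l4 \<longrightarrow>
        d1 \<ge> d2 \<and> d1 \<ge> d3 \<and> d1 \<ge> d4 \<and> d2 \<ge> d4 \<and> (d1 = d2 \<longrightarrow> d3 \<ge> d4))"

definition Bbar :: "nat \<Rightarrow> nat \<Rightarrow> (nat \<times> nat) set set" where
  "Bbar k r = {B \<in> boards k r.
     good_partition (lam k B 1) (lam k B 2) (lam k B 3) (lam k B 4)
                    (del k B 1) (del k B 2) (del k B 3) (del k B 4)}"

end

theory Submission
  imports Defs
begin

text \<open>
  The group acts on the pair of 4-cycles \<open>\<lambda>\<close> and \<open>\<delta>\<close> of a board partition through the symmetries of
  a square, fixing the centre entry. Conditions (i)--(iii) normalise \<open>\<lambda>\<close> within its orbit; the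
  remaining ones normalise \<open>\<delta>\<close> under the stabiliser of \<open>\<lambda>\<close>. So every orbit of partitions contains
  exactly one good partition.
\<close>

section \<open>Existence of a good partition in every orbit\<close>

lemma good_partition_eq_iff:
  "good_partition a a a a p q r s \<longleftrightarrow>
    q \<le> p \<and> r \<le> p \<and> s \<le> p \<and> s \<le> q \<and> (p = q \<longrightarrow> s \<le> r)"
  by (auto simp: good_partition_def)

text \<open>The stabiliser of (a, b, a, b) consists of the identity, the half turn and the two
  diagonal reflections. The condition says that (p, q, r, s) is lexicographically at least its
  images (q, p, s, r), (r, s, p, q) and (s, r, q, p).\<close>

lemma good_partition_opposite_iff:
  assumes "b < a"
  shows "good_partition a b a b p q r s \<longleftrightarrow> q \<le> p \<and> r \<le> p \<and> s \<le> p \<and>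
    (p = q \<longrightarrow> s \<le> r) \<and> (p = r \<longrightarrow> s \<le> q) \<and> (p = s \<longrightarrow> r \<le> q)"
  using assms by (auto simp: good_partition_def)

text \<open>The disjuncts follow the order of \<open>D4\<close>: four rotations, two midline
  reflections, two diagonal reflections. A midline reflection preserves two strips and no quadrant,
  a diagonal one two quadrants and no strip, whence the different patterns in the two
  cycles.\<close>

definition orbit_good :: "nat \<Rightarrow> nat \<Rightarrow> nat \<Rightarrow> nat \<Rightarrow> nat \<Rightarrow> nat \<Rightarrow> nat \<Rightarrow> nat \<Rightarrow> bool" where
  "orbit_good a b c d p q r s \<longleftrightarrow>
   good_partition a b c d p q r s \<or> good_partition d a b c s p q r \<or>
   good_partition c d a b r s p q \<or> good_partition b c d a q r s p \<or>
   good_partition d c b a r q p s \<or> good_partition b a d c p s r q \<or>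
   good_partition a d c b s r q p \<or> good_partition c b a d q p s r"

lemma orbit_good_rot: "orbit_good d a b c s p q r \<Longrightarrow> orbit_good a b c d p q r s"
  unfolding orbit_good_def by blast

lemma orbit_good_diag: "orbit_good a d c b s r q p \<Longrightarrow> orbit_good a b c d p q r s"
  unfolding orbit_good_def by blast

lemma orbit_good_all_equal:
  "orbit_good a a a a p q r s"
proof -
  \<comment> \<open>All eight symmetries fix \<lambda> here, so a largest \<delta> entry can be
    rotated to the front.\<close>
  have *: "orbit_good a a a a p q r s" if "q \<le> p" "r \<le> p" "s \<le> p" for p q r s
  proof -
    have "orbit_good a a a a p q r s" if "q \<le> p" "r \<le> p" "s \<le> q" "s \<le> p" for q s
    proof (cases "p = q \<longrightarrow> s \<le> r")
      case True then show ?thesis using that by (simp add: orbit_good_def good_partition_def)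
    next
      \<comment> \<open>Now p = q and r < s; the antidiagonal reflection exchanges p with q and r
        with s, which repairs the tie condition.\<close>
      case False then show ?thesis using that by (simp add: orbit_good_def good_partition_def)
    qed
    \<comment> \<open>The reflection that keeps p and r in place exchanges q and s.\<close>
    from this[of q s] this[of s q] that show ?thesis
      by (metis nat_le_linear orbit_good_diag orbit_good_rot)
  qed
  consider "q \<le> p" "r \<le> p" "s \<le> p" | "p \<le> q" "r \<le> q" "s \<le> q"
    | "p \<le> r" "q \<le> r" "s \<le> r" | "p \<le> s" "q \<le> s" "r \<le> s"
    by linarith
  then show ?thesis
    by cases (metis * orbit_good_rot)+
qed

lemma orbit_good_opposite_pairs:
  assumes "b < a"
  shows "orbit_good a b a b p q r s"
proof -
  have *: "orbit_good a b a b p q r s" if "q \<le> p" "r \<le> p" "s \<le> p" for p q r s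
  proof -
    \<comment> \<open>The lexicographically largest of the four images of (p, q, r, s) under the
      stabiliser is good.\<close>
    have "good_partition a b a b p q r s \<or> good_partition a b a b q p s r \<or>
        good_partition a b a b s r q p \<or> good_partition a b a b r s p q"
      unfolding good_partition_opposite_iff[OF assms] using that by (smt (verit) nat_le_linear le_antisym)
    then show ?thesis unfolding orbit_good_def by blast
  qed
  consider "q \<le> p" "r \<le> p" "s \<le> p" | "p \<le> q" "r \<le> q" "s \<le> q"
    | "p \<le> r" "q \<le> r" "s \<le> r" | "p \<le> s" "q \<le> s" "r \<le> s"
    by linarith
  then show ?thesis
    by cases (metis * orbit_good_rot orbit_good_diag)+
qed

text \<open>The cases run through the possible stabilisers of \<lambda>. In cases 1 to 3 the only
  nontrivial element is a reflection, and one of two tuples is good; in case 6 the stabiliser is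
  trivial and \<delta> is unconstrained.\<close>

lemma orbit_good_normalized:
  assumes "b \<le> a" "c \<le> a" "d \<le> a" "d \<le> b" "a = b \<longrightarrow> d \<le> c"
  shows "orbit_good a b c d p q r s"
proof -
  consider "a = c" "b \<noteq> d" | "b = d" "a \<noteq> c" | "a = b" "c < b" "c = d"
    | "a = c" "b = d" "b < a" | "a = b" "b = c" "c = d"
    | "a \<noteq> c" "b \<noteq> d" "\<not> (a = b \<and> c = d)"
    using assms by linarith
  then show ?thesis
  proof cases
    case 1
    have "good_partition a b c d p q r s \<or> good_partition c b a d q p s r"
      using 1 assms unfolding good_partition_def by (simp; linarith)
    then show ?thesis by (auto simp: orbit_good_def)
  next
    case 2
    have "good_partition a b c d p q r s \<or> good_partition a d c b s r q p"
      using 2 assms unfolding good_partition_def by (simp; linarith)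
    then show ?thesis by (auto simp: orbit_good_def)
  next
    case 3
    have "good_partition a b c d p q r s \<or> good_partition b a d c p s r q"
      using 3 assms unfolding good_partition_def by (simp; linarith)
    then show ?thesis by (auto simp: orbit_good_def)
  next
    case 4 then show ?thesis by (simp add: orbit_good_opposite_pairs)
  next
    case 5 then show ?thesis by (simp add: orbit_good_all_equal)
  next
    case 6
    then have "good_partition a b c d p q r s"
      using assms by (auto simp: good_partition_def)
    then show ?thesis by (simp add: orbit_good_def)
  qed
qed

lemma orbit_good_always: "orbit_good a b c d p q r s"
proof -
  have *: "orbit_good a b c d p q r s" if "b \<le> a" "c \<le> a" "d \<le> a" for a b c d p q r s
  proof -
    have **: "orbit_good a b c d p q r s" if "b \<le> a" "c \<le> a" "d \<le> b" for b d p q r s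
    proof (cases "a = b \<longrightarrow> d \<le> c")
      case True then show ?thesis using that orbit_good_normalized by simp
    next
      case False
      \<comment> \<open>Condition (iii) fails, so a = b and c < d; the left-right reflection
        exchanges c and d and leaves the leading pair equal.\<close>
      then have "orbit_good b a d c p s r q"
        using that by (intro orbit_good_normalized) auto
      then show ?thesis unfolding orbit_good_def by blast
    qed
    \<comment> \<open>Transposition exchanges b and d and keeps a in front.\<close>
    show ?thesis
      using **[of b d p q r s] **[of d b s r q p] that
      by (metis nat_le_linear orbit_good_diag)
  qed
  consider "b \<le> a" "c \<le> a" "d \<le> a" | "a \<le> b" "c \<le> b" "d \<le> b"
    | "a \<le> c" "b \<le> c" "d \<le> c" | "a \<le> d" "b \<le> d" "c \<le> d"
    by linarith
  then show ?thesis
    by cases (metis * orbit_good_rot)+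
qed

section \<open>Uniqueness: good partitions related by a symmetry coincide\<close>

lemma good_partition_normalized:
  "good_partition a b c d p q r s \<Longrightarrow>
    b \<le> a \<and> c \<le> a \<and> d \<le> a \<and> d \<le> b \<and> (a = b \<longrightarrow> d \<le> c)"
  unfolding good_partition_def by blast

text \<open>Here and in the next five lemmas the conclusion says that the symmetry fixes the
  partition. Normalisation of both tuples bounds the \<lambda> entries in both directions; the
  \<delta> conditions for the resulting \<lambda> then do the same for \<delta>.\<close>

lemma good_partition_rot:
  assumes "good_partition a b c d p q r s" "good_partition d a b c s p q r"
  shows "a = b \<and> b = c \<and> c = d \<and> p = q \<and> q = r \<and> r = s"
proof -
  have "a = b" "b = c" "c = d" using assms[THEN good_partition_normalized] by linarith+
  with assms show ?thesis unfolding good_partition_def by auto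
qed

lemma good_partition_half_turn:
  assumes "good_partition a b c d p q r s" "good_partition c d a b r s p q"
  shows "a = c \<and> b = d \<and> p = r \<and> q = s"
proof -
  have "a = c" "b = d" using assms[THEN good_partition_normalized] by linarith+
  moreover have "b \<le> a" using assms(1) by (simp add: good_partition_def)
  ultimately show ?thesis
    using assms by (cases "b = a") (auto simp: good_partition_eq_iff good_partition_opposite_iff)
qed

lemma good_partition_diag:
  assumes "good_partition a b c d p q r s" "good_partition a d c b s r q p"
  shows "b = d \<and> p = s \<and> q = r"
proof -
  have "b = d" using assms[THEN good_partition_normalized] by linarith
  moreover have "b \<le> a" using assms(1) by (simp add: good_partition_def)
  moreover have "p = s \<and> q = r" if "a \<noteq> c"
    using assms \<open>b = d\<close> that unfolding good_partition_def by (metis le_antisym)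
  ultimately show ?thesis
    using assms
    by (cases "a = c"; cases "b = a")
      (auto simp: good_partition_eq_iff good_partition_opposite_iff)
qed

lemma good_partition_horizontal:
  assumes "good_partition a b c d p q r s" "good_partition d c b a r q p s"
  shows "a = d \<and> b = c \<and> p = r"
proof -
  have "a = b" "b = c" "c = d" using assms[THEN good_partition_normalized] by linarith+
  with assms show ?thesis unfolding good_partition_def by auto
qed

lemma good_partition_antidiag:
  assumes "good_partition a b c d p q r s" "good_partition c b a d q p s r"
  shows "a = c \<and> p = q \<and> r = s"
proof -
  have "a = c" using assms[THEN good_partition_normalized] by linarith
  moreover have "b \<le> a" using assms(1) by (simp add: good_partition_def)
  moreover have "p = q \<and> r = s" if "b \<noteq> d"
    using assms \<open>a = c\<close> that unfolding good_partition_def by (metis le_antisym)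
  ultimately show ?thesis
    using assms
    by (cases "b = d"; cases "b = a")
      (auto simp: good_partition_eq_iff good_partition_opposite_iff)
qed

lemma good_partition_vertical:
  assumes "good_partition a b c d p q r s" "good_partition b a d c p s r q"
  shows "a = b \<and> c = d \<and> q = s"
proof -
  have "a = b" "c = d" using assms[THEN good_partition_normalized] by linarith+
  with assms show ?thesis unfolding good_partition_def by auto
qed

section \<open>The action of the symmetries on boards and on their partitions\<close>

definition rot :: "nat \<Rightarrow> nat \<times> nat \<Rightarrow> nat \<times> nat" where
  "rot k = (\<lambda>(i, j). (j, 2*k+2 - i))"

lemma rot_grid: "x \<in> grid k \<Longrightarrow> rot k x \<in> grid k"
  by (auto simp: rot_def grid_def)

lemma swap_grid: "x \<in> grid k \<Longrightarrow> prod.swap x \<in> grid k"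
  by (auto simp: grid_def)

text \<open>Truncated subtraction destroys injectivity on all pairs of naturals, but grid
  coordinates are at most 2k+1.\<close>

lemma rot_inj: "inj_on (rot k) (grid k)"
  by (auto simp: rot_def grid_def inj_on_def)

text \<open>Regions are compared on \<open>G\<close> only, so values of \<open>g\<close> outside the
  grid, where subtraction truncates, do not matter.\<close>

lemma card_image_region:
  assumes "B \<subseteq> G" "inj_on g G" "\<And>x. x \<in> G \<Longrightarrow> g x \<in> V \<longleftrightarrow> x \<in> U"
  shows "card (g ` B \<inter> V) = card (B \<inter> U)"
proof -
  have "g ` B \<inter> V = g ` (B \<inter> U)" using assms(1,3) by blast
  then show ?thesis
    using assms(1,2) by (metis card_image inf.coboundedI1 inj_on_subset)
qed

lemma board_partition_rot:
  assumes "B \<subseteq> grid k" and "board_partition k B = ((a, b, c, d), (p, q, r, s), e)"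
  shows "board_partition k (rot k ` B) = ((d, a, b, c), (s, p, q, r), e)"
proof -
  note region = card_image_region[OF assms(1) rot_inj]
  have "board_partition k (rot k ` B) =
     ((lam k B 4, lam k B 1, lam k B 2, lam k B 3),
      (del k B 4, del k B 1, del k B 2, del k B 3), cen k B)"
    unfolding board_partition_def lam_def del_def cen_def prod.inject
    by (intro conjI region; auto simp: rot_def grid_def Lambda_def Delta_def center_def)
  with assms(2) show ?thesis by (simp add: board_partition_def)
qed

lemma board_partition_swap:
  assumes "B \<subseteq> grid k" and "board_partition k B = ((a, b, c, d), (p, q, r, s), e)"
  shows "board_partition k (prod.swap ` B) = ((a, d, c, b), (s, r, q, p), e)"
proof -
  note region = card_image_region[OF assms(1) inj_on_subset[OF inj_swap subset_UNIV]]
  have "board_partition k (prod.swap ` B) =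
     ((lam k B 1, lam k B 4, lam k B 3, lam k B 2),
      (del k B 4, del k B 3, del k B 2, del k B 1), cen k B)"
    unfolding board_partition_def lam_def del_def cen_def prod.inject
    by (intro conjI region; auto simp: grid_def Lambda_def Delta_def center_def)
  with assms(2) show ?thesis by (simp add: board_partition_def)
qed

text \<open>Expresses \<open>D4\<close> through two generators, the quarter turn and the
  transposition, so that partitions need tracking under these alone. Images of \<open>B\<close> are
  compared because the maps can differ outside the grid.\<close>

lemma D4_images:
  assumes "B \<subseteq> grid k"
  shows "(\<lambda>g. g ` B) ` D4 k =
    {B, rot k ` B, rot k ` rot k ` B, rot k ` rot k ` rot k ` B,
     prod.swap ` rot k ` B, prod.swap ` rot k ` rot k ` rot k ` B, prod.swap ` B,
     prod.swap ` rot k ` rot k ` B}"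
proof -
  have le: "i \<le> 2*k+2" "j \<le> 2*k+2" if "(i, j) \<in> B" for i j
    using assms that by (auto simp: grid_def)
  \<comment> \<open>Both equations rest on m - (m - i) = i with m = 2k+2, which needs the bounds
    \<open>le\<close>.\<close>
  have "(\<lambda>(i, j). (2*k+2 - j, i)) ` B = rot k ` rot k ` rot k ` B"
    "(\<lambda>(i, j). (i, 2*k+2 - j)) ` B = prod.swap ` rot k ` rot k ` rot k ` B"
    unfolding image_image by (intro image_cong; use le in \<open>force simp: rot_def\<close>)+
  moreover have "(\<lambda>(i, j). (i, j)) ` B = B"
    "(\<lambda>(i, j). (j, 2*k+2 - i)) ` B = rot k ` B"
    "(\<lambda>(i, j). (2*k+2 - i, 2*k+2 - j)) ` B = rot k ` rot k ` B"
    "(\<lambda>(i, j). (j, i)) ` B = prod.swap ` B"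
    "(\<lambda>(i, j). (2*k+2 - i, j)) ` B = prod.swap ` rot k ` B"
    "(\<lambda>(i, j). (2*k+2 - j, 2*k+2 - i)) ` B = prod.swap ` rot k ` rot k ` B"
    by (auto simp: rot_def image_image case_prod_beta intro!: image_cong)
  ultimately show ?thesis
    unfolding D4_def Let_def image_insert image_empty by (simp only:)
qed

lemma boards_rot: "B \<in> boards k r \<Longrightarrow> rot k ` B \<in> boards k r"
  using rot_grid card_image inj_on_subset[OF rot_inj] unfolding boards_def by blast

lemma boards_swap: "B \<in> boards k r \<Longrightarrow> prod.swap ` B \<in> boards k r"
  using swap_grid by (auto simp: boards_def card_image)

lemma boards_D4:
  assumes "B \<in> boards k r" and "g \<in> D4 k"
  shows "g ` B \<in> boards k r"
proof -
  have "B \<subseteq> grid k" using assms(1) by (simp add: boards_def)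
  then have "g ` B \<in> (\<lambda>g. g ` B) ` D4 k" using assms(2) by blast
  then show ?thesis
    unfolding D4_images[OF \<open>B \<subseteq> grid k\<close>]
    by (elim insertE emptyE) (simp_all only: assms(1) boards_rot boards_swap)
qed

definition good :: "(nat \<times> nat \<times> nat \<times> nat) \<times> (nat \<times> nat \<times> nat \<times> nat) \<times> nat \<Rightarrow> bool" where
  "good = (\<lambda>((a, b, c, d), (p, q, r, s), e). good_partition a b c d p q r s)"

lemma Bbar_iff: "B \<in> Bbar k r \<longleftrightarrow> B \<in> boards k r \<and> good (board_partition k B)"
  by (simp add: Bbar_def good_def board_partition_def)

lemma D4_partitions:
  assumes "B \<subseteq> grid k" and "board_partition k B = ((a, b, c, d), (p, q, r, s), e)"
  shows "(\<lambda>g. board_partition k (g ` B)) ` D4 k =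
    {((a, b, c, d), (p, q, r, s), e), ((d, a, b, c), (s, p, q, r), e),
     ((c, d, a, b), (r, s, p, q), e), ((b, c, d, a), (q, r, s, p), e),
     ((d, c, b, a), (r, q, p, s), e), ((b, a, d, c), (p, s, r, q), e),
     ((a, d, c, b), (s, r, q, p), e), ((c, b, a, d), (q, p, s, r), e)}"
proof -
  have rot: "rot k ` C \<subseteq> grid k" if "C \<subseteq> grid k" for C
    using that rot_grid by blast
  have "(\<lambda>g. board_partition k (g ` B)) ` D4 k = board_partition k ` (\<lambda>g. g ` B) ` D4 k"
    by (simp add: image_image)
  also have "\<dots> = {((a, b, c, d), (p, q, r, s), e), ((d, a, b, c), (s, p, q, r), e),
     ((c, d, a, b), (r, s, p, q), e), ((b, c, d, a), (q, r, s, p), e),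
     ((d, c, b, a), (r, q, p, s), e), ((b, a, d, c), (p, s, r, q), e),
     ((a, d, c, b), (s, r, q, p), e), ((c, b, a, d), (q, p, s, r), e)}"
    by (simp add: D4_images assms board_partition_rot board_partition_swap rot)
  finally show ?thesis .
qed

theorem theorem4p3:
  fixes k r :: nat
  assumes "k \<ge> 1" and "1 \<le> r" and "r \<le> (2*k+1)^2"
  shows "(\<exists>S. Bbar k r = (\<Union>P\<in>S. {B \<in> boards k r. board_partition k B = P}) \<and>
              disjoint_family_on (\<lambda>P. {B \<in> boards k r. board_partition k B = P}) S)
       \<and> (\<forall>B \<in> boards k r. \<exists>B' \<in> Bbar k r. board_equiv k B B')
       \<and> (\<forall>B \<in> Bbar k r. \<forall>B' \<in> Bbar k r.
            board_equiv k B B' \<longrightarrow> board_partition k B = board_partition k B')"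
proof (intro conjI ballI impI)
  show "\<exists>S. Bbar k r = (\<Union>P\<in>S. {B \<in> boards k r. board_partition k B = P}) \<and>
              disjoint_family_on (\<lambda>P. {B \<in> boards k r. board_partition k B = P}) S"
    \<comment> \<open>Good tuples realised by no board contribute the empty set.\<close>
    by (rule exI[of _ "Collect good"]) (auto simp: Bbar_iff disjoint_family_on_def)
next
  fix B assume B: "B \<in> boards k r"
  obtain a b c d p q u s e where P: "board_partition k B = ((a, b, c, d), (p, q, u, s), e)"
    by (metis surj_pair)
  \<comment> \<open>The eight disjuncts of \<open>orbit_good\<close> are the goodness of the eight
    tuples in \<open>D4_partitions\<close>.\<close>
  have "\<exists>x \<in> (\<lambda>g. board_partition k (g ` B)) ` D4 k. good x"
    using orbit_good_always[of a b c d p q u s] B P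
    by (simp add: D4_partitions boards_def good_def orbit_good_def)
  then obtain g where g: "g \<in> D4 k" "good (board_partition k (g ` B))"
    by blast
  then have "g ` B \<in> Bbar k r" "board_equiv k B (g ` B)"
    using boards_D4[OF B g(1)] by (auto simp: Bbar_iff board_equiv_def)
  then show "\<exists>B' \<in> Bbar k r. board_equiv k B B'" ..
next
  fix B B' assume B: "B \<in> Bbar k r" "B' \<in> Bbar k r" "board_equiv k B B'"
  obtain a b c d p q u s e where P: "board_partition k B = ((a, b, c, d), (p, q, u, s), e)"
    by (metis surj_pair)
  have grid: "B \<subseteq> grid k" and good: "good_partition a b c d p q u s"
    and good': "good (board_partition k B')"
    using B(1,2) P by (auto simp: Bbar_iff boards_def good_def)
  have "board_partition k B' \<in> (\<lambda>g. board_partition k (g ` B)) ` D4 k"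
    using B(3) by (auto simp: board_equiv_def)
  then show "board_partition k B = board_partition k B'"
    using good' unfolding D4_partitions[OF grid P] P good_def
    \<comment> \<open>The three-quarter turn is inverse to the quarter turn, so
      \<open>good_partition_rot\<close> covers it with its two assumptions exchanged.\<close>
    by (elim insertE emptyE; simp)
      (blast dest: good_partition_rot[OF good] good_partition_rot[OF _ good]
         good_partition_half_turn[OF good] good_partition_diag[OF good]
         good_partition_horizontal[OF good] good_partition_antidiag[OF good]
         good_partition_vertical[OF good])+
qed

end
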